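(* Let $n\ge1$, let $L_B(n)$ be the set of all partitions of $n$ and $\Phi\subseteq L_B(n)$ the set of all $SPM(n)$-fixed points. For $P\in\Phi$ let $U_{SPM(n)}(P)=\{a\in L_B(n) : a\ge_{SPM}P\}$. Then $\{U_{SPM(n)}(P): P\in\Phi\}$ is a set partition of $L_B(n)$, i.e. $L_B(n)=\bigcup_{P\in\Phi}U_{SPM(n)}(P)$ and for all $P_1\ne P_2$ in $\Phi$, $U_{SPM(n)}(P_1)\cap U_{SPM(n)}(P_2)=\emptyset$.
   Context: A partition of $n$ is a sequence $a=(a_1,\ldots,a_n)$ of nonnegative integers with $a_1\ge a_2\ge\cdots\ge a_n$ and $\sum a_i=n$. The $SPM$ rule (vertical rule) transforms a partition $a$ into $(a_1,\ldots,a_i-1,a_{i+1}+1,\ldots,a_n)$ for an index $1\le i\le n-1$ with $a_i-a_{i+1}\ge 2$. For partitions $a,b$ of $n$, $a\ge_{SPM}b$ means that $b$ can be obtained from $a$ by a (possibly empty) finite sequence of applications of the $SPM$ rule. An $SPM(n)$-fixed point is a partition of $n$ on which the $SPM$ rule cannot be applied at any position. *)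

theory Defs
  imports Main "HOL-Library.Disjoint_Sets"
begin

text \<open>Sequences are 0-indexed lists: \<open>a ! i\<close> is the part usually written with index \<open>i + 1\<close>.
  A partition of \<open>n\<close> has exactly \<open>n\<close> entries, padded with trailing zeros.\<close>

definition int_partitions :: "nat \<Rightarrow> nat list set" where
  "int_partitions n = {a. length a = n \<and> sorted_wrt (\<ge>) a \<and> sum_list a = n}"

definition spm_rule :: "nat \<Rightarrow> nat list \<Rightarrow> nat list \<Rightarrow> bool" where
  "spm_rule n a b \<longleftrightarrow> a \<in> int_partitions n \<and>
     (\<exists>i. Suc i < n \<and> a ! i \<ge> a ! Suc i + 2 \<and>
          b = a[i := a ! i - 1, Suc i := a ! Suc i + 1])"

definition spm_ge :: "nat \<Rightarrow> nat list \<Rightarrow> nat list \<Rightarrow> bool" where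
  "spm_ge n a b \<longleftrightarrow> a \<in> int_partitions n \<and> b \<in> int_partitions n \<and> (spm_rule n)\<^sup>*\<^sup>* a b"

definition spm_fixed_points :: "nat \<Rightarrow> nat list set" where
  "spm_fixed_points n = {P \<in> int_partitions n. \<not> (\<exists>b. spm_rule n P b)}"

definition spm_upper :: "nat \<Rightarrow> nat list \<Rightarrow> nat list set" where
  "spm_upper n P = {a \<in> int_partitions n. spm_ge n a P}"

end

theory Submission
  imports Defs "HOL-Library.Confluence"
begin

text \<open>The rule is a terminating, confluent rewriting system on the partitions of
  \<open>n\<close>, so every partition has exactly one normal form and the upper sets are the fibres
  of the normal-form map. Each move is a lexicographic descent (\<open>spm_rule_lexn\<close>), so a
  fixed point is always reached (\<open>ex_spm_fixed_point\<close>). Two different moves stay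
  available after each other and commute (\<open>spm_rule_diamond\<close>), which gives confluence
  and hence uniqueness (\<open>spm_fixed_point_unique\<close>).\<close>

text \<open>The move without its enabling condition, so that moves at two positions can be composed
  and compared.\<close>

definition spm_fire :: "nat \<Rightarrow> nat list \<Rightarrow> nat list" where
  "spm_fire i a = a[i := a ! i - 1, Suc i := a ! Suc i + 1]"

lemma spm_rule_iff:
  "spm_rule n a b \<longleftrightarrow> a \<in> int_partitions n \<and>
     (\<exists>i. Suc i < n \<and> a ! i \<ge> a ! Suc i + 2 \<and> b = spm_fire i a)"
  by (simp add: spm_rule_def spm_fire_def)

lemma length_spm_fire [simp]: "length (spm_fire i a) = length a"
  by (simp add: spm_fire_def)

lemma nth_spm_fire:
  assumes "Suc i < length a"
  shows "spm_fire i a ! j =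
    (if j = i then a ! i - 1 else if j = Suc i then a ! Suc i + 1 else a ! j)"
  using assms by (auto simp: spm_fire_def nth_list_update)

lemma sum_list_spm_fire:
  assumes "Suc i < length a" "a ! i > 0"
  shows "sum_list (spm_fire i a) = sum_list a"
proof -
  \<comment> \<open>This bound makes the truncated subtractions in \<open>sum_list_update\<close>
    exact.\<close>
  have "a ! i \<le> sum_list a"
    using assms by (intro elem_le_sum_list) auto
  then show ?thesis
    using assms by (simp add: spm_fire_def sum_list_update)
qed

lemma int_partitions_decreasing:
  assumes "a \<in> int_partitions n" "i \<le> j" "j < n"
  shows "a ! j \<le> a ! i"
  using assms by (cases "i = j") (auto simp: int_partitions_def sorted_wrt_iff_nth_less)

text \<open>Only the gap at \<open>i\<close> shrinks, by 2, and it was at least 2; the gaps on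
  either side of it grow.\<close>

lemma spm_fire_in_int_partitions:
  assumes a: "a \<in> int_partitions n" and i: "Suc i < n" "a ! i \<ge> a ! Suc i + 2"
  shows "spm_fire i a \<in> int_partitions n"
proof -
  have len: "length a = n" and sum: "sum_list a = n"
    using a by (auto simp: int_partitions_def)
  have "spm_fire i a ! k \<le> spm_fire i a ! j" if "j < k" "k < n" for j k
  proof -
    have "a ! k \<le> a ! j" "k > Suc i \<longrightarrow> a ! k \<le> a ! Suc i" "j < i \<longrightarrow> a ! i \<le> a ! j"
      using int_partitions_decreasing[OF a] that i by auto
    then show ?thesis
      using that i by (auto simp: nth_spm_fire len)
  qed
  then show ?thesis
    using i len sum by (simp add: int_partitions_def sorted_wrt_iff_nth_less sum_list_spm_fire)
qed

lemma spm_rule_in_int_partitions: "spm_rule n a b \<Longrightarrow> b \<in> int_partitions n"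
  by (auto simp: spm_rule_iff spm_fire_in_int_partitions)

text \<open>Firing adds a fixed integer vector, and such additions commute; positivity keeps
  truncated subtraction from interfering.\<close>

lemma spm_fire_commute:
  assumes "Suc i < length a" "Suc j < length a" "a ! i > 0" "a ! j > 0"
  shows "spm_fire i (spm_fire j a) = spm_fire j (spm_fire i a)"
  using assms by (intro nth_equalityI) (auto simp: nth_spm_fire)

text \<open>Firing one position never disables another: it can only raise the gap at the neighbouring
  positions.\<close>

lemma spm_rule_diamond:
  assumes "spm_rule n a b" "spm_rule n a c" "b \<noteq> c"
  shows "\<exists>d. spm_rule n b d \<and> spm_rule n c d"
proof -
  obtain i j where i: "Suc i < n" "a ! i \<ge> a ! Suc i + 2" "b = spm_fire i a"
    and j: "Suc j < n" "a ! j \<ge> a ! Suc j + 2" "c = spm_fire j a"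
    using assms by (auto simp: spm_rule_iff)
  have len: "length a = n"
    using assms(1) by (auto simp: spm_rule_iff int_partitions_def)
  have "i \<noteq> j"
    using i j assms(3) by auto
  then have "b ! j \<ge> b ! Suc j + 2" "c ! i \<ge> c ! Suc i + 2"
    using i j len by (auto simp: nth_spm_fire)
  moreover have "spm_fire j b = spm_fire i c"
    using i j len by (simp add: spm_fire_commute)
  moreover have "b \<in> int_partitions n" "c \<in> int_partitions n"
    using assms by (simp_all add: spm_rule_in_int_partitions)
  ultimately have "spm_rule n b (spm_fire j b)" "spm_rule n c (spm_fire j b)"
    using i(1) j(1) by (auto simp: spm_rule_iff)
  then show ?thesis
    by blast
qed

lemma confluentp_spm_rule: "confluentp (spm_rule n)"
proof (intro strong_confluentp_imp_confluentp strong_confluentpI)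
  fix a b c
  assume "spm_rule n a b" "spm_rule n a c"
  then show "\<exists>d. (spm_rule n)\<^sup>*\<^sup>* b d \<and> (spm_rule n)\<^sup>=\<^sup>= c d"
    \<comment> \<open>If \<open>b = c\<close>, zero steps on both sides close the diagram.\<close>
    using spm_rule_diamond by (cases "b = c") blast+
qed

text \<open>The leftmost entry that changes is the one at the fired position, and it drops. Since
  all lists have length \<open>n\<close>, the order is well-founded.\<close>

lemma spm_rule_lexn:
  assumes "spm_rule n a b"
  shows "(b, a) \<in> lexn less_than n"
proof -
  obtain i where i: "Suc i < n" "a ! i \<ge> a ! Suc i + 2" "b = spm_fire i a"
    using assms by (auto simp: spm_rule_iff)
  have len: "length a = n"
    using assms by (auto simp: spm_rule_iff int_partitions_def)
  have "take i b = take i a"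
    by (simp add: i spm_fire_def)
  moreover have "b ! i < a ! i" "length b = n"
    using i len by (auto simp: nth_spm_fire)
  moreover have "a = take i a @ a ! i # drop (Suc i) a"
    using i(1) len by (intro id_take_nth_drop) simp
  moreover have "b = take i b @ b ! i # drop (Suc i) b"
    using i(1) \<open>length b = n\<close> by (intro id_take_nth_drop) simp
  ultimately have "\<exists>us x y xs ys. b = us @ x # xs \<and> a = us @ y # ys \<and> (x, y) \<in> less_than"
    by (metis less_than_iff)
  then show ?thesis
    using \<open>length b = n\<close> len unfolding lexn_conv by blast
qed

lemma ex_spm_fixed_point:
  assumes "a \<in> int_partitions n"
  shows "\<exists>P\<in>spm_fixed_points n. spm_ge n a P"
proof -
  have "wf (lexn less_than n)"
    by (simp add: wf_lexn)
  then show ?thesis using assms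
  proof (induction a rule: wf_induct_rule)
    case (less a)
    show ?case
    proof (cases "\<exists>b. spm_rule n a b")
      case True
      then obtain b where b: "spm_rule n a b" by blast
      then obtain P where "P \<in> spm_fixed_points n" "spm_ge n b P"
        using less.IH spm_rule_lexn spm_rule_in_int_partitions by blast
      then show ?thesis
        using b less.prems by (auto simp: spm_ge_def intro: converse_rtranclp_into_rtranclp)
    next
      case False
      then show ?thesis
        using less.prems by (auto simp: spm_fixed_points_def spm_ge_def)
    qed
  qed
qed

text \<open>Confluence gives \<open>P\<close> and \<open>Q\<close> a common reduct, but a fixed
  point reduces only to itself.\<close>

lemma spm_fixed_point_unique:
  assumes "spm_ge n a P" "spm_ge n a Q" "P \<in> spm_fixed_points n" "Q \<in> spm_fixed_points n"
  shows "P = Q"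
proof -
  obtain d where "(spm_rule n)\<^sup>*\<^sup>* P d" "(spm_rule n)\<^sup>*\<^sup>* Q d"
    using assms confluentpD[OF confluentp_spm_rule] unfolding spm_ge_def by blast
  then show ?thesis
    using assms(3,4) unfolding spm_fixed_points_def by (blast elim: converse_rtranclpE)
qed

theorem theorem2:
  fixes n :: nat
  assumes "n \<ge> 1"
  shows "partition_on (int_partitions n) (spm_upper n ` spm_fixed_points n)
    \<and> int_partitions n = (\<Union>P\<in>spm_fixed_points n. spm_upper n P)
    \<and> (\<forall>P1\<in>spm_fixed_points n. \<forall>P2\<in>spm_fixed_points n.
          P1 \<noteq> P2 \<longrightarrow> spm_upper n P1 \<inter> spm_upper n P2 = {})"
proof -
  have cover: "int_partitions n = (\<Union>P\<in>spm_fixed_points n. spm_upper n P)"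
    using ex_spm_fixed_point by (auto simp: spm_upper_def)
  have disj: "\<forall>P1\<in>spm_fixed_points n. \<forall>P2\<in>spm_fixed_points n.
      P1 \<noteq> P2 \<longrightarrow> spm_upper n P1 \<inter> spm_upper n P2 = {}"
    using spm_fixed_point_unique by (fastforce simp: spm_upper_def)
  \<comment> \<open>The empty path puts \<open>P\<close> in its own block, so no block is
    empty.\<close>
  have "P \<in> spm_upper n P" if "P \<in> spm_fixed_points n" for P
    using that by (simp add: spm_upper_def spm_ge_def spm_fixed_points_def)
  then have "{} \<notin> spm_upper n ` spm_fixed_points n"
    by blast
  \<comment> \<open>\<open>disjoint\<close> compares distinct sets of the family, and these come
    from distinct fixed points.\<close>
  moreover have "disjoint (spm_upper n ` spm_fixed_points n)"
    using disj by (intro disjointI, elim imageE) metis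
  ultimately have "partition_on (int_partitions n) (spm_upper n ` spm_fixed_points n)"
    using cover by (simp add: partition_on_def)
  then show ?thesis
    using cover disj by (intro conjI)
qed

end
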